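(* Let $\alpha\in[0,1]$. The radius of convexity of the class $\mathcal{BK}(\alpha)$ is $$r_\alpha=\frac{\sqrt{1+4\alpha}-1}{2\alpha},$$ where for $\alpha=0$ the right-hand side is understood as its limit as $\alpha\to0^+$, namely $r_0=1$.
   Context: $\mathbb{D}=\{z\in\mathbb{C}:|z|<1\}$. $\mathcal{A}$ is the class of analytic functions $f$ in $\mathbb{D}$ with $f(0)=0$, $f'(0)=1$. For analytic $f,g$ in $\mathbb{D}$, $f$ is subordinate to $g$, written $f\prec g$, if there is an analytic $\omega:\mathbb{D}\to\mathbb{D}$ with $\omega(0)=0$ and $f(z)=g(\omega(z))$ for all $z\in\mathbb{D}$. For $0\le\alpha\le1$ let $F_\alpha(z)=\dfrac{z}{1-\alpha z^2}$, and let $\mathcal{BK}(\alpha)$ be the class of $f\in\mathcal{A}$ such that $\dfrac{zf''(z)}{f'(z)}\prec F_\alpha(z)$ (in particular $zf''/f'$ is analytic in $\mathbb{D}$). The radius of convexity of a class $\mathcal{F}\subset\mathcal{A}$ is the largest number $s\in[0,1]$ such that $\operatorname{Re}\left(1+\dfrac{zf''(z)}{f'(z)}\right)>0$ for all $|z|<s$ and all $f\in\mathcal{F}$. *)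

theory Defs
  imports "HOL-Complex_Analysis.Complex_Analysis" "HOL-Real_Asymp.Real_Asymp"
begin

abbreviation unit_disc :: "complex set" where
  "unit_disc \<equiv> ball 0 1"

(* Functions on the disc are total functions on the complex plane; their values outside
   the (open) disc are irrelevant, also for the derivatives. *)
definition normalized_analytic :: "(complex \<Rightarrow> complex) set" where
  "normalized_analytic = {f. f holomorphic_on unit_disc \<and> f 0 = 0 \<and> deriv f 0 = 1}"

definition subordinate :: "(complex \<Rightarrow> complex) \<Rightarrow> (complex \<Rightarrow> complex) \<Rightarrow> bool" where
  "subordinate f g \<longleftrightarrow>
     f holomorphic_on unit_disc \<and> g holomorphic_on unit_disc \<and>
     (\<exists>\<omega>. \<omega> holomorphic_on unit_disc \<and> \<omega> ` unit_disc \<subseteq> unit_disc \<and> \<omega> 0 = 0 \<and>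
          (\<forall>z\<in>unit_disc. f z = g (\<omega> z)))"

definition booth :: "real \<Rightarrow> complex \<Rightarrow> complex" where
  "booth \<alpha> z = z / (1 - of_real \<alpha> * z\<^sup>2)"

(* A zero of f' in the disc would be a pole of z f''/f', so analyticity of this quotient
   means that f' has no zeros; this is made explicit because x / 0 = 0 in HOL. *)
definition BK :: "real \<Rightarrow> (complex \<Rightarrow> complex) set" where
  "BK \<alpha> = {f \<in> normalized_analytic.
     (\<forall>z\<in>unit_disc. deriv f z \<noteq> 0) \<and>
     subordinate (\<lambda>z. z * deriv (deriv f) z / deriv f z) (booth \<alpha>)}"

(* The conjunct deriv f z \<noteq> 0 says that the quotient is defined at z. *)
definition convex_within :: "(complex \<Rightarrow> complex) set \<Rightarrow> real \<Rightarrow> bool" where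
  "convex_within \<F> s \<longleftrightarrow>
     (\<forall>f\<in>\<F>. \<forall>z. norm z < s \<longrightarrow>
        deriv f z \<noteq> 0 \<and> Re (1 + z * deriv (deriv f) z / deriv f z) > 0)"

definition is_radius_of_convexity :: "(complex \<Rightarrow> complex) set \<Rightarrow> real \<Rightarrow> bool" where
  "is_radius_of_convexity \<F> r \<longleftrightarrow>
     r \<in> {0..1} \<and> convex_within \<F> r \<and>
     (\<forall>s\<in>{0..1}. convex_within \<F> s \<longrightarrow> s \<le> r)"

definition BK_radius :: "real \<Rightarrow> real" where
  "BK_radius \<alpha> = (if \<alpha> = 0 then 1 else (sqrt (1 + 4 * \<alpha>) - 1) / (2 * \<alpha>))"

(* Justifies the value BK_radius 0 = 1. *)
lemma BK_radius_limit:
  "((\<lambda>\<alpha>::real. (sqrt (1 + 4 * \<alpha>) - 1) / (2 * \<alpha>)) \<longlongrightarrow> BK_radius 0) (at_right 0)"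
  unfolding BK_radius_def by simp real_asymp

end

theory Submission
  imports Defs
begin

text \<open>The number \<open>r = BK_radius \<alpha>\<close> solves \<open>\<alpha> r\<^sup>2 + r = 1\<close>. By the Schwarz lemma
  \<open>z f''(z) / f'(z)\<close> is a value of \<open>booth \<alpha>\<close> at a point of norm at most \<open>norm z\<close>, and
  \<open>norm (booth \<alpha> w) \<le> norm w / (1 - \<alpha> (norm w)\<^sup>2) < 1\<close> when \<open>norm w < r\<close>. The bound is attained
  at \<open>- r\<close> by the \<open>f\<close> with \<open>f''(z) / f'(z) = 1 / (1 - \<alpha> z\<^sup>2)\<close>, since \<open>booth \<alpha> (- r) = - 1\<close>.\<close>

text \<open>Positivity permits cancelling the radius when \<open>booth\<close> is evaluated at its
  negative; the upper bound keeps points of smaller norm in the disc.\<close>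

lemma BK_radius_in_unit_interval:
  assumes "\<alpha> \<in> {0..1}"
  shows "BK_radius \<alpha> \<in> {0<..1}"
proof (cases "\<alpha> = 0")
  case False
  with assms have "\<alpha> > 0" by simp
  moreover have "1 < sqrt (1 + 4 * \<alpha>)"
    using \<open>\<alpha> > 0\<close> by simp
  moreover have "sqrt (1 + 4 * \<alpha>) \<le> 1 + 2 * \<alpha>"
    using \<open>\<alpha> > 0\<close> by (intro real_le_lsqrt) (auto simp: power2_eq_square algebra_simps)
  ultimately show ?thesis
    by (simp add: BK_radius_def)
qed (simp add: BK_radius_def)

lemma BK_radius_equation:
  assumes "\<alpha> \<ge> 0"
  shows "\<alpha> * (BK_radius \<alpha>)\<^sup>2 + BK_radius \<alpha> = 1"
proof (cases "\<alpha> = 0")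
  case False
  have "(sqrt (1 + 4 * \<alpha>))\<^sup>2 = 1 + 4 * \<alpha>"
    using assms by simp
  with False show ?thesis
    by (simp add: BK_radius_def power_divide power2_diff divide_simps power2_eq_square)
      (simp add: algebra_simps)
qed (simp add: BK_radius_def)

text \<open>For \<alpha> in [0,1] the subtracted term has norm below 1 on the disc. Hence
  \<open>booth \<alpha>\<close> is holomorphic there.\<close>

lemma booth_denominator_nonzero:
  assumes "\<alpha> \<in> {0..1}" and "norm z < 1"
  shows "1 - of_real \<alpha> * z\<^sup>2 \<noteq> (0::complex)"
proof
  assume "1 - of_real \<alpha> * z\<^sup>2 = 0"
  then have "of_real \<alpha> * z\<^sup>2 = 1" by simp
  then have "norm (of_real \<alpha> * z\<^sup>2) = 1" by (metis norm_one)
  then have "\<alpha> * (norm z)\<^sup>2 = 1"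
    using assms(1) by (simp add: norm_mult norm_power)
  moreover have "\<alpha> * (norm z)\<^sup>2 \<le> (norm z)\<^sup>2"
    using assms(1) by (simp add: mult_left_le_one_le)
  moreover have "(norm z)\<^sup>2 < 1"
    using assms(2) by (simp add: power_less_one_iff abs_square_less_1)
  ultimately show False by linarith
qed

lemma norm_booth_less_one:
  assumes "\<alpha> \<in> {0..1}" and "norm z < BK_radius \<alpha>"
  shows "norm (booth \<alpha> z) < 1"
proof -
  \<comment> \<open>Strictness comes from the linear term, so \<open>\<alpha> = 0\<close> needs no
    separate case.\<close>
  have "\<alpha> * (norm z)\<^sup>2 + norm z < \<alpha> * (BK_radius \<alpha>)\<^sup>2 + BK_radius \<alpha>"
    using assms by (intro add_le_less_mono mult_left_mono power_mono) auto
  then have "norm z < 1 - \<alpha> * (norm z)\<^sup>2"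
    using BK_radius_equation[of \<alpha>] assms(1) by simp
  also have "\<dots> = norm (1::complex) - norm (of_real \<alpha> * z\<^sup>2)"
    using assms(1) by (simp add: norm_mult norm_power)
  also have "\<dots> \<le> norm (1 - of_real \<alpha> * z\<^sup>2)"
    by (rule norm_triangle_ineq2)
  finally have less: "norm z < norm (1 - of_real \<alpha> * z\<^sup>2)" .
  moreover have "0 < norm (1 - of_real \<alpha> * z\<^sup>2)"
    using less norm_ge_zero[of z] by linarith
  ultimately show ?thesis
    by (simp add: booth_def norm_divide)
qed

text \<open>The witness is \<open>\<omega> z\<close> for the subordinating function
  \<open>\<omega>\<close>, to which the Schwarz lemma applies.\<close>

lemma subordinate_norm_le_witness:
  assumes "subordinate f g" and "norm z < 1"
  obtains w where "norm w \<le> norm z" and "f z = g w"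
proof -
  obtain \<omega> where \<omega>: "\<omega> holomorphic_on unit_disc" "\<omega> ` unit_disc \<subseteq> unit_disc" "\<omega> 0 = 0"
    and eq: "\<forall>z\<in>unit_disc. f z = g (\<omega> z)"
    using assms(1) unfolding subordinate_def by blast
  have "norm (\<omega> z) < 1" if "norm z < 1" for z
    using \<omega>(2) that by (simp add: image_subset_iff)
  then have "norm (\<omega> z) \<le> norm z"
    using Schwarz_Lemma(1) \<omega> assms(2) by blast
  with that eq assms(2) show thesis by simp
qed

lemma convex_within_BK_radius:
  assumes "\<alpha> \<in> {0..1}"
  shows "convex_within (BK \<alpha>) (BK_radius \<alpha>)"
  unfolding convex_within_def
proof (intro ballI allI impI)
  fix f and z :: complex
  assume f: "f \<in> BK \<alpha>" and z: "norm z < BK_radius \<alpha>"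
  have z1: "norm z < 1"
    using z BK_radius_in_unit_interval[OF assms] by simp
  let ?q = "z * deriv (deriv f) z / deriv f z"
  have "subordinate (\<lambda>z. z * deriv (deriv f) z / deriv f z) (booth \<alpha>)"
    using f by (simp add: BK_def)
  then obtain w where w: "norm w \<le> norm z" "?q = booth \<alpha> w"
    using z1 by (rule subordinate_norm_le_witness)
  then have "norm ?q < 1"
    using norm_booth_less_one[OF assms, of w] z by simp
  \<comment> \<open>Here \<open>Re ?q \<ge> - norm ?q > -1\<close>.\<close>
  then have "Re (1 + ?q) > 0"
    using abs_Re_le_cmod[of ?q] unfolding plus_complex.sel one_complex.sel by linarith
  moreover have "deriv f z \<noteq> 0"
    using f z1 by (simp add: BK_def)
  ultimately show "deriv f z \<noteq> 0 \<and> Re (1 + ?q) > 0" by simp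
qed

text \<open>Integrating \<open>f'' / f' = h\<close> gives \<open>f'\<close> as the exponential of a
  primitive of \<open>h\<close>; a second integration gives \<open>f\<close>. Both primitives exist
  because the disc is convex.\<close>

lemma exists_normalized_pre_Schwarzian:
  assumes "h holomorphic_on unit_disc"
  obtains f where "f \<in> normalized_analytic"
    and "\<And>z. z \<in> unit_disc \<Longrightarrow> deriv f z \<noteq> 0"
    and "\<And>z. z \<in> unit_disc \<Longrightarrow> deriv (deriv f) z / deriv f z = h z"
proof -
  obtain g where g: "\<And>z. z \<in> unit_disc \<Longrightarrow> (g has_field_derivative h z) (at z)"
    using holomorphic_convex_primitive'[OF convex_ball open_ball assms]
    by (metis at_within_open open_ball)
  \<comment> \<open>This will be the derivative of \<open>f\<close>: subtracting \<open>g 0\<close>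
    makes it 1 at the origin, and an exponential has no zeros.\<close>
  define e where "e = (\<lambda>z. exp (g z - g 0))"
  have e': "(e has_field_derivative e z * h z) (at z)" if "z \<in> unit_disc" for z
    unfolding e_def by (auto intro!: derivative_eq_intros g that)
  have "e holomorphic_on unit_disc"
    using e' holomorphic_on_open open_ball by blast
  then obtain F where F: "\<And>z. z \<in> unit_disc \<Longrightarrow> (F has_field_derivative e z) (at z)"
    using holomorphic_convex_primitive'[OF convex_ball open_ball]
    by (metis at_within_open open_ball)
  define f where "f = (\<lambda>z. F z - F 0)"
  have f': "(f has_field_derivative e z) (at z)" if "z \<in> unit_disc" for z
    unfolding f_def by (auto intro!: derivative_eq_intros F that)
  have df: "deriv f z = e z" if "z \<in> unit_disc" for z
    using f'[OF that] by (rule DERIV_imp_deriv)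
  have ddf: "deriv (deriv f) z = e z * h z" if "z \<in> unit_disc" for z
  proof -
    \<comment> \<open>\<open>deriv f\<close> is known to equal \<open>e\<close> only on the disc; as
      the disc is open, the derivative carries over.\<close>
    have "(deriv f has_field_derivative e z * h z) (at z)"
      using e'[OF that] open_ball that
      by (rule has_field_derivative_transform_within_open) (simp add: df)
    then show ?thesis by (rule DERIV_imp_deriv)
  qed
  show thesis
  proof (rule that)
    have "f holomorphic_on unit_disc"
      using f' holomorphic_on_open open_ball by blast
    then show "f \<in> normalized_analytic"
      by (simp add: normalized_analytic_def df) (simp add: f_def e_def)
  qed (simp_all add: df ddf, simp_all add: e_def)
qed

lemma subordinate_refl:
  assumes "f holomorphic_on unit_disc"
  shows "subordinate f f"
  unfolding subordinate_def using assms
  by (intro conjI exI[of _ "\<lambda>z. z"]) auto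

text \<open>The quotient built from the extremal function agrees with \<open>booth \<alpha>\<close>
  only on the disc, so the two cannot be exchanged as total functions.\<close>

lemma subordinate_cong_left:
  assumes "subordinate f h" and "\<And>z. z \<in> unit_disc \<Longrightarrow> f z = g z"
  shows "subordinate g h"
  using assms holomorphic_cong[of unit_disc unit_disc f g] unfolding subordinate_def by simp

text \<open>Prescribing \<open>f'' / f'\<close> as \<open>booth \<alpha> z / z\<close>, with the
  singularity at 0 removed, makes the identity a subordinating function.\<close>

lemma exists_BK_extremal:
  assumes "\<alpha> \<in> {0..1}"
  obtains f where "f \<in> BK \<alpha>"
    and "\<And>z. z \<in> unit_disc \<Longrightarrow> z * deriv (deriv f) z / deriv f z = booth \<alpha> z"
proof -
  have "(\<lambda>z. 1 / (1 - of_real \<alpha> * z\<^sup>2)) holomorphic_on unit_disc"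
    using booth_denominator_nonzero[OF assms] by (intro holomorphic_intros) simp
  then obtain f where f: "f \<in> normalized_analytic"
      "\<And>z. z \<in> unit_disc \<Longrightarrow> deriv f z \<noteq> 0"
      "\<And>z. z \<in> unit_disc \<Longrightarrow> deriv (deriv f) z / deriv f z = 1 / (1 - of_real \<alpha> * z\<^sup>2)"
    by (rule exists_normalized_pre_Schwarzian) blast
  have eq: "z * deriv (deriv f) z / deriv f z = booth \<alpha> z" if "z \<in> unit_disc" for z
    using f(3)[OF that] unfolding booth_def
    by (metis mult.right_neutral times_divide_eq_right)
  have "booth \<alpha> holomorphic_on unit_disc"
    unfolding booth_def using booth_denominator_nonzero[OF assms]
    by (intro holomorphic_intros) simp
  then have "subordinate (\<lambda>z. z * deriv (deriv f) z / deriv f z) (booth \<alpha>)"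
    by (intro subordinate_cong_left[OF subordinate_refl]) (simp_all add: eq)
  with f(1,2) have "f \<in> BK \<alpha>" by (simp add: BK_def)
  with eq that show thesis by blast
qed

text \<open>By the quadratic equation the denominator at this point is the radius itself.\<close>

lemma booth_minus_BK_radius:
  assumes "\<alpha> \<in> {0..1}"
  shows "booth \<alpha> (- of_real (BK_radius \<alpha>)) = -1"
proof -
  let ?r = "BK_radius \<alpha>"
  have "1 - \<alpha> * ?r\<^sup>2 = ?r"
    using BK_radius_equation[of \<alpha>] assms by simp
  then have "1 - of_real \<alpha> * (- of_real ?r)\<^sup>2 = (of_real ?r :: complex)"
    by (metis of_real_1 of_real_diff of_real_mult of_real_power power2_minus)
  moreover have "?r \<noteq> 0"
    using BK_radius_in_unit_interval[OF assms] by simp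
  ultimately show ?thesis
    by (simp add: booth_def)
qed

theorem theorem3p2:
  fixes \<alpha> :: real
  assumes "\<alpha> \<in> {0..1}"
  shows "is_radius_of_convexity (BK \<alpha>) (BK_radius \<alpha>)"
  unfolding is_radius_of_convexity_def
proof (intro conjI ballI impI)
  show "BK_radius \<alpha> \<in> {0..1}"
    using BK_radius_in_unit_interval[OF assms] by simp
  show "convex_within (BK \<alpha>) (BK_radius \<alpha>)"
    by (rule convex_within_BK_radius[OF assms])
  fix s :: real
  assume s: "s \<in> {0..1}" and convex: "convex_within (BK \<alpha>) s"
  obtain f where f: "f \<in> BK \<alpha>"
      "\<And>z. z \<in> unit_disc \<Longrightarrow> z * deriv (deriv f) z / deriv f z = booth \<alpha> z"
    using exists_BK_extremal[OF assms] by blast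
  show "s \<le> BK_radius \<alpha>"
  proof (rule ccontr)
    assume "\<not> s \<le> BK_radius \<alpha>"
    \<comment> \<open>The extremal function has \<open>1 + z f''(z) / f'(z) = 0\<close> here. The
      point lies in the open disc because its norm is below \<open>s\<close>, and
      \<open>s \<le> 1\<close>.\<close>
    define z :: complex where "z = - of_real (BK_radius \<alpha>)"
    have z: "norm z < s"
      using \<open>\<not> s \<le> BK_radius \<alpha>\<close> BK_radius_in_unit_interval[OF assms]
      by (simp add: z_def)
    then have "Re (1 + z * deriv (deriv f) z / deriv f z) > 0"
      using convex f(1) unfolding convex_within_def by blast
    moreover have "z * deriv (deriv f) z / deriv f z = -1"
      using f(2)[of z] z s booth_minus_BK_radius[OF assms] by (simp add: z_def)
    ultimately show False by simp
  qed
qed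

end
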